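(* Let $A\in\mathbb{R}^{n\times n}$, $B\in\mathbb{R}^{n\times m_1}$, $C\in\mathbb{R}^{p_1\times n}$, $D\in\mathbb{R}^{p_1\times m_1}$, $E\in\mathbb{R}^{n\times p_2}$ be the matrices of a quantum plant with nonsingular CCR matrix $\Theta_1\in\mathbb{A}_n$, so that the plant physical realizability conditions $$A\Theta_1+\Theta_1A^{\mathrm T}+BJ_1B^{\mathrm T}+E\widetilde J_2E^{\mathrm T}=0,\qquad C\Theta_1+DJ_1B^{\mathrm T}=0$$ hold. Let $a\in\mathbb{R}^{n\times n}$, $b\in\mathbb{R}^{n\times m_2}$, $c\in\mathbb{R}^{p_2\times n}$, $d\in\mathbb{R}^{p_2\times m_2}$, $e\in\mathbb{R}^{n\times p_1}$ be the matrices of a coherent quantum controller with CCR matrix $\Theta_2=-\Theta_1$, so that the controller physical realizability conditions $$a\Theta_2+\Theta_2a^{\mathrm T}+bJ_2b^{\mathrm T}+e\widetilde J_1e^{\mathrm T}=0,\qquad c\Theta_2+dJ_2b^{\mathrm T}=0$$ hold. Suppose the controller has the Luenberger structure $a=A-eC+Ec$. Then the controller gain matrices $b,e$ satisfy $$(B-eD)J_1(B-eD)^{\mathrm T}+(Ed-b)J_2(Ed-b)^{\mathrm T}=0.$$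
   Context: $\mathbb{A}_r$ denotes the space of real antisymmetric matrices of order $r$; $I_r$ is the identity matrix of order $r$; $\otimes$ is the Kronecker product. The dimensions $n,m_1,m_2,p_1,p_2$ are even positive integers with $p_1\le m_1$, $p_2\le m_2$. Put $$\mathbf J:=\begin{bmatrix}0&1\\-1&0\end{bmatrix},\qquad J_k:=I_{m_k/2}\otimes\mathbf J\quad(k=1,2).$$ The feedthrough matrix $D$ (respectively $d$) is formed from conjugate pairs of rows of a permutation matrix of order $m_1$ (respectively $m_2$), so that $DD^{\mathrm T}=I_{p_1}$, $dd^{\mathrm T}=I_{p_2}$, and $$\widetilde J_1:=DJ_1D^{\mathrm T}=I_{p_1/2}\otimes\mathbf J,\qquad \widetilde J_2:=dJ_2d^{\mathrm T}=I_{p_2/2}\otimes\mathbf J.$$ Background (interpretation only): the plant is the open quantum harmonic oscillator $\mathrm dx=Ax\,\mathrm dt+B\,\mathrm dw+E\,\mathrm d\eta$, $\mathrm dy=Cx\,\mathrm dt+D\,\mathrm dw$, with $[x,x^{\mathrm T}]=2i\Theta_1$. The controller is the open quantum harmonic oscillator $\mathrm d\xi=a\xi\,\mathrm dt+b\,\mathrm d\omega+e\,\mathrm dy$, $\mathrm d\eta=c\xi\,\mathrm dt+d\,\mathrm d\omega$, with $[\xi,\xi^{\mathrm T}]=2i\Theta_2$. Here $w,\omega$ are quantum Wiener processes with $[\mathrm dw,\mathrm dw^{\mathrm T}]=2iJ_1\mathrm dt$, $[\mathrm d\omega,\mathrm d\omega^{\mathrm T}]=2iJ_2\mathrm dt$.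 The Luenberger structure means $\mathrm d\xi=A\xi\,\mathrm dt+b\,\mathrm d\omega+e(\mathrm dy-C\xi\,\mathrm dt)+Ec\xi\,\mathrm dt$. CCR stands for canonical commutation relations. *)

theory Defs
  imports "Jordan_Normal_Form.Matrix" "HOL-Combinatorics.Permutations"
begin

text \<open>All indices start at 0.\<close>

definition kronecker_mat :: "'a :: times mat \<Rightarrow> 'a mat \<Rightarrow> 'a mat" (infixl "\<otimes>\<^sub>K" 70) where
  "X \<otimes>\<^sub>K Y = mat (dim_row X * dim_row Y) (dim_col X * dim_col Y)
     (\<lambda>(i, j). X $$ (i div dim_row Y, j div dim_col Y) * Y $$ (i mod dim_row Y, j mod dim_col Y))"

definition bold_J :: "real mat" where
  "bold_J = mat_of_rows_list 2 [[0, 1], [-1, 0]]"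

definition antisymmetric_mat :: "real mat \<Rightarrow> bool" where
  "antisymmetric_mat X \<longleftrightarrow> square_mat X \<and> X\<^sup>T = - X"

definition permutation_mat :: "nat \<Rightarrow> real mat \<Rightarrow> bool" where
  "permutation_mat m P \<longleftrightarrow>
     (\<exists>\<pi>. \<pi> permutes {..<m} \<and> P = mat m m (\<lambda>(i, j). if j = \<pi> i then 1 else 0))"

text \<open>The conjugate pairs are the rows with (0-based) numbers \<open>2 * k\<close> and \<open>2 * k + 1\<close>, the
  2-by-2 block structure of \<^term>\<open>1\<^sub>m (m div 2) \<otimes>\<^sub>K bold_J\<close>. The map \<open>\<sigma>\<close> selects distinct pairs,
  in any order.\<close>

definition conjugate_row_pairs :: "nat \<Rightarrow> nat \<Rightarrow> real mat \<Rightarrow> real mat \<Rightarrow> bool" where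
  "conjugate_row_pairs p m P X \<longleftrightarrow> X \<in> carrier_mat p m \<and>
     (\<exists>\<sigma>. inj_on \<sigma> {..<p div 2} \<and> \<sigma> ` {..<p div 2} \<subseteq> {..<m div 2} \<and>
        (\<forall>k < p div 2. row X (2 * k) = row P (2 * \<sigma> k) \<and> row X (2 * k + 1) = row P (2 * \<sigma> k + 1)))"

end

theory Submission
  imports Defs
begin

text \<open>Since \<open>\<Theta>\<^sub>2 = - \<Theta>\<^sub>1\<close>, adding the two Lyapunov-type realizability conditions leaves only
  \<open>A - a = e C - E c\<close> acting on \<open>\<Theta>\<^sub>1\<close>. The remaining two conditions give
  \<open>C \<Theta>\<^sub>1 = - D J\<^sub>1 B\<^sup>T\<close> and \<open>c \<Theta>\<^sub>1 = d J\<^sub>2 b\<^sup>T\<close>, which turn these terms and their transposes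
  into the cross terms of the two claimed quadratic forms.\<close>

lemma transpose_kronecker_mat: "(X \<otimes>\<^sub>K Y)\<^sup>T = X\<^sup>T \<otimes>\<^sub>K Y\<^sup>T"
proof (rule eq_matI)
  fix i j assume "i < dim_row (X\<^sup>T \<otimes>\<^sub>K Y\<^sup>T)" "j < dim_col (X\<^sup>T \<otimes>\<^sub>K Y\<^sup>T)"
  then have "i < dim_col X * dim_col Y" "j < dim_row X * dim_row Y"
    by (simp_all add: kronecker_mat_def)
  \<comment> \<open>An index below a product forces both factors to be nonzero. This keeps the
    \<open>mod\<close> indices into \<open>Y\<close> in range, as the \<open>div\<close> indices
    into \<open>X\<close> are by the bound itself.\<close>
  moreover from this have "dim_col Y > 0" "dim_row Y > 0"
    by (auto intro: gr0I)
  ultimately show "(X \<otimes>\<^sub>K Y)\<^sup>T $$ (i, j) = (X\<^sup>T \<otimes>\<^sub>K Y\<^sup>T) $$ (i, j)"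
    by (simp add: kronecker_mat_def less_mult_imp_div_less)
qed (simp_all add: kronecker_mat_def)

lemma kronecker_mat_uminus_right:
  fixes X Y :: "'a :: ring mat"
  shows "X \<otimes>\<^sub>K (- Y) = - (X \<otimes>\<^sub>K Y)"
proof (rule eq_matI)
  fix i j assume "i < dim_row (- (X \<otimes>\<^sub>K Y))" "j < dim_col (- (X \<otimes>\<^sub>K Y))"
  then have "i < dim_row X * dim_row Y" "j < dim_col X * dim_col Y"
    by (simp_all add: kronecker_mat_def)
  moreover from this have "dim_col Y > 0" "dim_row Y > 0"
    by (auto intro: gr0I)
  ultimately show "(X \<otimes>\<^sub>K (- Y)) $$ (i, j) = (- (X \<otimes>\<^sub>K Y)) $$ (i, j)"
    by (simp add: kronecker_mat_def less_mult_imp_div_less)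
qed (simp_all add: kronecker_mat_def)

lemma bold_J_carrier: "bold_J \<in> carrier_mat 2 2"
  by (simp add: bold_J_def mat_of_rows_list_def numeral_2_eq_2)

lemma transpose_bold_J: "bold_J\<^sup>T = - bold_J"
  by (rule eq_matI) (auto simp: bold_J_def mat_of_rows_list_def numeral_2_eq_2 less_Suc_eq)

text \<open>Evenness is what makes \<open>m div 2\<close> blocks of order 2 add up to order exactly
  \<open>m\<close>.\<close>

lemma canonical_J_carrier:
  assumes "even m"
  shows "1\<^sub>m (m div 2) \<otimes>\<^sub>K bold_J \<in> carrier_mat m m"
  using assms bold_J_carrier by (auto simp: kronecker_mat_def)

text \<open>The identity factor is symmetric, so the product inherits the antisymmetry of
  \<open>bold_J\<close>.\<close>

lemma transpose_canonical_J: "(1\<^sub>m k \<otimes>\<^sub>K bold_J)\<^sup>T = - (1\<^sub>m k \<otimes>\<^sub>K bold_J)"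
  by (simp add: transpose_kronecker_mat transpose_bold_J kronecker_mat_uminus_right)

text \<open>Distributivity on both sides. The two cross terms stay separate, since each is later
  matched with a term of the realizability conditions.\<close>

lemma congruence_diff_mat:
  fixes X Y J :: "'a :: comm_ring mat"
  assumes X: "X \<in> carrier_mat n m" and Y: "Y \<in> carrier_mat n m" and J: "J \<in> carrier_mat m m"
  shows "(X - Y) * J * (X - Y)\<^sup>T = X * J * X\<^sup>T - Y * J * X\<^sup>T - (X * J * Y\<^sup>T - Y * J * Y\<^sup>T)"
proof -
  have "(X - Y) * J = X * J - Y * J"
    using assms by (rule minus_mult_distrib_mat)
  moreover have "(X - Y)\<^sup>T = X\<^sup>T - Y\<^sup>T"
    using X Y by (rule transpose_minus)
  moreover have "(X * J - Y * J) * (X\<^sup>T - Y\<^sup>T) = (X * J - Y * J) * X\<^sup>T - (X * J - Y * J) * Y\<^sup>T"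
    by (rule mult_minus_distrib_mat) (use assms in auto)
  moreover have "(X * J - Y * J) * X\<^sup>T = X * J * X\<^sup>T - Y * J * X\<^sup>T"
    by (rule minus_mult_distrib_mat) (use assms in auto)
  moreover have "(X * J - Y * J) * Y\<^sup>T = X * J * Y\<^sup>T - Y * J * Y\<^sup>T"
    by (rule minus_mult_distrib_mat) (use assms in auto)
  ultimately show ?thesis by simp
qed

lemma transpose_triple_mult_mat:
  fixes X Y Z :: "'a :: comm_semiring_0 mat"
  assumes "X \<in> carrier_mat k l" "Y \<in> carrier_mat l m" "Z \<in> carrier_mat m n"
  shows "(X * Y * Z)\<^sup>T = Z\<^sup>T * Y\<^sup>T * X\<^sup>T"
proof -
  have "(X * Y * Z)\<^sup>T = Z\<^sup>T * (X * Y)\<^sup>T"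
    using assms by (intro transpose_mult) auto
  also have "(X * Y)\<^sup>T = Y\<^sup>T * X\<^sup>T"
    using assms by (intro transpose_mult) auto
  also have "Z\<^sup>T * (Y\<^sup>T * X\<^sup>T) = Z\<^sup>T * Y\<^sup>T * X\<^sup>T"
    using assms by (intro assoc_mult_mat[symmetric, of _ n m _ l _ k]) auto
  finally show ?thesis .
qed

lemma assoc_mult_quadruple_mat:
  fixes W X Y Z :: "'a :: semiring_0 mat"
  assumes "W \<in> carrier_mat j k" "X \<in> carrier_mat k l" "Y \<in> carrier_mat l m" "Z \<in> carrier_mat m n"
  shows "W * (X * Y * Z) = W * X * Y * Z"
proof -
  have "W * (X * Y * Z) = W * (X * Y) * Z"
    using assms by (intro assoc_mult_mat[symmetric]) auto
  also have "W * (X * Y) = W * X * Y"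
    using assms by (intro assoc_mult_mat[symmetric]) auto
  finally show ?thesis .
qed

text \<open>Transposition reverses the triple product and \<open>J\<close> contributes the sign, so
  the two cross terms of a quadratic form in \<open>J\<close> are negative transposes of each
  other.\<close>

lemma antisymmetric_congruence:
  fixes X Y J :: "'a :: comm_ring mat"
  assumes "X \<in> carrier_mat k m" "Y \<in> carrier_mat n m" "J \<in> carrier_mat m m" "J\<^sup>T = - J"
  shows "(X * J * Y\<^sup>T)\<^sup>T = - (Y * J * X\<^sup>T)"
  using assms transpose_triple_mult_mat[of X k m J m "Y\<^sup>T" n] by auto

theorem theorem1:
  fixes n m1 m2 p1 p2 :: nat
    and A B C D E \<Theta>1 a b c d e \<Theta>2 J1 J2 Jt1 Jt2 :: "real mat"
  assumes dims: "n > 0" "even n" "m1 > 0" "even m1" "m2 > 0" "even m2"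
      "p1 > 0" "even p1" "p2 > 0" "even p2" "p1 \<le> m1" "p2 \<le> m2"
    and J1: "J1 = 1\<^sub>m (m1 div 2) \<otimes>\<^sub>K bold_J"
    and J2: "J2 = 1\<^sub>m (m2 div 2) \<otimes>\<^sub>K bold_J"
    and plant: "A \<in> carrier_mat n n" "B \<in> carrier_mat n m1" "C \<in> carrier_mat p1 n"
      "D \<in> carrier_mat p1 m1" "E \<in> carrier_mat n p2"
    and controller: "a \<in> carrier_mat n n" "b \<in> carrier_mat n m2" "c \<in> carrier_mat p2 n"
      "d \<in> carrier_mat p2 m2" "e \<in> carrier_mat n p1"
    and D: "\<exists>P. permutation_mat m1 P \<and> conjugate_row_pairs p1 m1 P D" "D * D\<^sup>T = 1\<^sub>m p1"
    and d: "\<exists>P. permutation_mat m2 P \<and> conjugate_row_pairs p2 m2 P d" "d * d\<^sup>T = 1\<^sub>m p2"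
    and Jt1: "Jt1 = D * J1 * D\<^sup>T" "Jt1 = 1\<^sub>m (p1 div 2) \<otimes>\<^sub>K bold_J"
    and Jt2: "Jt2 = d * J2 * d\<^sup>T" "Jt2 = 1\<^sub>m (p2 div 2) \<otimes>\<^sub>K bold_J"
    and \<Theta>1: "\<Theta>1 \<in> carrier_mat n n" "antisymmetric_mat \<Theta>1" "invertible_mat \<Theta>1"
    and \<Theta>2: "\<Theta>2 = - \<Theta>1"
    and plant_PR: "A * \<Theta>1 + \<Theta>1 * A\<^sup>T + B * J1 * B\<^sup>T + E * Jt2 * E\<^sup>T = 0\<^sub>m n n"
      "C * \<Theta>1 + D * J1 * B\<^sup>T = 0\<^sub>m p1 n"
    and controller_PR: "a * \<Theta>2 + \<Theta>2 * a\<^sup>T + b * J2 * b\<^sup>T + e * Jt1 * e\<^sup>T = 0\<^sub>m n n"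
      "c * \<Theta>2 + d * J2 * b\<^sup>T = 0\<^sub>m p2 n"
    and Luenberger: "a = A - e * C + E * c"
  shows "(B - e * D) * J1 * (B - e * D)\<^sup>T + (E * d - b) * J2 * (E * d - b)\<^sup>T = 0\<^sub>m n n"
proof -
  define T where "T = \<Theta>1"
  have T: "T \<in> carrier_mat n n" and TT: "T\<^sup>T = - T"
    using \<Theta>1 by (simp_all add: T_def antisymmetric_mat_def)
  have J1c: "J1 \<in> carrier_mat m1 m1" and J2c: "J2 \<in> carrier_mat m2 m2"
    unfolding J1 J2 using dims by (auto intro: canonical_J_carrier)
  have J1T: "J1\<^sup>T = - J1" and J2T: "J2\<^sup>T = - J2"
    unfolding J1 J2 by (simp_all add: transpose_canonical_J)
  note car = plant controller T J1c J2c
  \<comment> \<open>\<open>U\<close> and \<open>V\<close> are one cross term from each claimed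
    quadratic form, bracketed so that the inner product is the one occurring in the realizability
    conditions for \<open>C\<close> and \<open>c\<close>.\<close>
  define U where "U = e * (D * J1 * B\<^sup>T)"
  define V where "V = E * (d * J2 * b\<^sup>T)"
  have U: "U \<in> carrier_mat n n" and V: "V \<in> carrier_mat n n"
    using car by (auto simp: U_def V_def)
  have U': "U = (e * D) * J1 * B\<^sup>T"
    unfolding U_def by (rule assoc_mult_quadruple_mat) (use car in auto)
  have V': "V = (E * d) * J2 * b\<^sup>T"
    unfolding V_def by (rule assoc_mult_quadruple_mat) (use car in auto)
  have CT: "C * T = - (D * J1 * B\<^sup>T)"
  proof (rule eq_matI)
    fix i j assume "i < dim_row (- (D * J1 * B\<^sup>T))" "j < dim_col (- (D * J1 * B\<^sup>T))"
    then show "(C * T) $$ (i, j) = (- (D * J1 * B\<^sup>T)) $$ (i, j)"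
      using arg_cong[OF plant_PR(2), of "\<lambda>M. M $$ (i, j)"] car
      by (simp add: T_def eq_neg_iff_add_eq_0)
  qed (use car in auto)
  \<comment> \<open>The sign differs from that in \<open>CT\<close> because \<open>\<Theta>2\<close>
    is the negative of \<open>T\<close>.\<close>
  have cT: "c * T = d * J2 * b\<^sup>T"
  proof (rule eq_matI)
    fix i j assume "i < dim_row (d * J2 * b\<^sup>T)" "j < dim_col (d * J2 * b\<^sup>T)"
    then show "(c * T) $$ (i, j) = (d * J2 * b\<^sup>T) $$ (i, j)"
      using arg_cong[OF controller_PR(2), of "\<lambda>M. M $$ (i, j)"] car
      by (simp add: T_def \<Theta>2)
  qed (use car in auto)
  have eCT: "e * C * T = - U"
    using car by (simp add: CT U_def)
  have EcT: "E * c * T = V"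
    using car by (simp add: cT V_def)
  \<comment> \<open>The Luenberger structure enters here. The minus sign before \<open>e * C\<close>
    cancels the one in \<open>eCT\<close>, so both corrections to \<open>A * T\<close> come out
    positive.\<close>
  have "a * T = (A - e * C) * T + E * c * T"
    unfolding Luenberger by (rule add_mult_distrib_mat) (use car in auto)
  also have "(A - e * C) * T = A * T - e * C * T"
    by (rule minus_mult_distrib_mat) (use car in auto)
  finally have aT: "a * T = A * T + U + V"
    using U V car by (auto simp: eCT EcT)
  \<comment> \<open>Antisymmetry of \<open>T\<close> lets each Lyapunov-type expression be written
    through \<open>X * T\<close> and its transpose alone.\<close>
  have mult_transpose_T: "T * X\<^sup>T = - (X * T)\<^sup>T" if "X \<in> carrier_mat n n" for X
    using that T TT transpose_mult[of X n n T n] by auto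
  \<comment> \<open>\<open>W\<close> and \<open>Z\<close> are the remaining cross terms, the
    negative transposes of \<open>U\<close> and \<open>V\<close>.\<close>
  define W where "W = B * J1 * (e * D)\<^sup>T"
  define Z where "Z = b * J2 * (E * d)\<^sup>T"
  have UT: "U\<^sup>T = - W"
    unfolding U' W_def by (rule antisymmetric_congruence) (use car J1T in auto)
  have VT: "V\<^sup>T = - Z"
    unfolding V' Z_def by (rule antisymmetric_congruence) (use car J2T in auto)
  have aTT: "(a * T)\<^sup>T = (A * T)\<^sup>T + - W + - Z"
    unfolding aT UT[symmetric] VT[symmetric]
    using U V car transpose_add[of "A * T + U" n n V] transpose_add[of "A * T" n n U]
    by auto
  define S where "S = A * T"
  define P1 where "P1 = B * J1 * B\<^sup>T"
  define P2 where "P2 = (E * d) * J2 * (E * d)\<^sup>T"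
  define Q1 where "Q1 = (e * D) * J1 * (e * D)\<^sup>T"
  define Q2 where "Q2 = b * J2 * b\<^sup>T"
  have carriers: "W \<in> carrier_mat n n" "Z \<in> carrier_mat n n" "S \<in> carrier_mat n n"
    "P1 \<in> carrier_mat n n" "P2 \<in> carrier_mat n n" "Q1 \<in> carrier_mat n n" "Q2 \<in> carrier_mat n n"
    using car by (auto simp: W_def Z_def S_def P1_def P2_def Q1_def Q2_def)
  \<comment> \<open>With \<open>Jt1\<close> and \<open>Jt2\<close> written as congruences by
    \<open>D\<close> and \<open>d\<close>, this produces the squares of \<open>e * D\<close> and
    \<open>E * d\<close> in the claim.\<close>
  have congr: "X * (Y * J * Y\<^sup>T) * X\<^sup>T = (X * Y) * J * (X * Y)\<^sup>T"
    if "X \<in> carrier_mat n p" "Y \<in> carrier_mat p m" "J \<in> carrier_mat m m" for X Y J :: "real mat" and p m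
  proof -
    have "X * (Y * J * Y\<^sup>T) = X * Y * J * Y\<^sup>T"
      using that by (intro assoc_mult_quadruple_mat) auto
    moreover have "X * Y * J * Y\<^sup>T * X\<^sup>T = X * Y * J * (Y\<^sup>T * X\<^sup>T)"
      using that by (intro assoc_mult_mat) auto
    ultimately show ?thesis
      using transpose_mult[OF that(1,2)] by simp
  qed
  have "E * Jt2 * E\<^sup>T = P2"
    unfolding Jt2(1) P2_def using car by (intro congr)
  then have plant_sum: "S + - S\<^sup>T + P1 + P2 = 0\<^sub>m n n"
    using plant_PR(1) mult_transpose_T[OF plant(1)] by (simp add: S_def P1_def T_def)
  have "e * Jt1 * e\<^sup>T = Q1"
    unfolding Jt1(1) Q1_def using car by (intro congr)
  moreover have "a * \<Theta>2 = - (a * T)" and "\<Theta>2 * a\<^sup>T = (a * T)\<^sup>T"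
    unfolding \<Theta>2 T_def[symmetric] using mult_transpose_T[OF controller(1)] car by simp_all
  ultimately have controller_sum:
    "- (S + U + V) + (S\<^sup>T + - W + - Z) + Q2 + Q1 = 0\<^sub>m n n"
    using controller_PR(1) unfolding aTT unfolding aT by (simp add: Q2_def S_def)
  have "(B - e * D) * J1 * (B - e * D)\<^sup>T = P1 - U - (W - Q1)"
    unfolding P1_def U' W_def Q1_def by (rule congruence_diff_mat) (use car in auto)
  moreover have "(E * d - b) * J2 * (E * d - b)\<^sup>T = P2 - Z - (V - Q2)"
    unfolding P2_def Z_def V' Q2_def by (rule congruence_diff_mat) (use car in auto)
  \<comment> \<open>In the sum of \<open>plant_sum\<close> and \<open>controller_sum\<close> the
    terms \<open>S\<close> and \<open>S\<^sup>T\<close> cancel. What is left is this expression,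
    compared entrywise as an identity between real numbers.\<close>
  moreover have "P1 - U - (W - Q1) + (P2 - Z - (V - Q2)) = 0\<^sub>m n n"
  proof (rule eq_matI)
    fix i j assume "i < dim_row (0\<^sub>m n n :: real mat)" "j < dim_col (0\<^sub>m n n :: real mat)"
    then show "(P1 - U - (W - Q1) + (P2 - Z - (V - Q2))) $$ (i, j) = 0\<^sub>m n n $$ (i, j)"
      using arg_cong[OF plant_sum, of "\<lambda>M. M $$ (i, j)"]
        arg_cong[OF controller_sum, of "\<lambda>M. M $$ (i, j)"] carriers U V
      by simp
  qed (use carriers U V in auto)
  ultimately show ?thesis by simp
qed

end
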